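(* For any regular function $f=f^*\in L^1(I)$ there exist $\delta=\delta(f)$ with $0<\delta<1$ and a constant $C>0$ such that $$f^{**}(t)\le C t^{-\delta},\qquad t\in I.$$
   Context: $I=(0,1]$ with Lebesgue measure $\lambda$. For $f\in L^1(I)$, $f^*$ is the non-increasing right-continuous function on $I$ equimeasurable with $|f|$; $f=f^*$ means $f$ is itself such a function; $f^{**}(t)=\frac1t\int_0^tf^*d\lambda$. A function $f\in L^1(I)$ is regular if there is a constant $K>0$ such that $f^{**}(t)\le K f^*(t)$ for all $t\in I$. *)

theory Defs
  imports "HOL-Analysis.Analysis"
begin

definition unit_I :: "real set" where
  "unit_I = {0<..1}"

text \<open>Continuity at \<^term>\<open>t\<close> within \<^term>\<open>{t..1}\<close> is right continuity of a function whose domain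
  is \<^term>\<open>unit_I\<close>; at the endpoint \<^term>\<open>1\<close> it is no condition. Letting \<^term>\<open>s\<close> range over
  all reals (not only \<open>s \<ge> 0\<close>) forces \<^term>\<open>g\<close> to be nonnegative almost everywhere.\<close>

definition is_rearrangement :: "(real \<Rightarrow> real) \<Rightarrow> (real \<Rightarrow> real) \<Rightarrow> bool" where
  "is_rearrangement f g \<longleftrightarrow>
     antimono_on unit_I g \<and>
     (\<forall>t\<in>unit_I. continuous (at t within {t..1}) g) \<and>
     (\<forall>s. measure lebesgue {x \<in> unit_I. g x > s} = measure lebesgue {x \<in> unit_I. \<bar>f x\<bar> > s})"

text \<open>Being a rearrangement determines \<^term>\<open>g\<close> on the open interval \<open>(0,1)\<close> only: at \<^term>\<open>1\<close>
  right continuity is vacuous and the value there does not affect equimeasurability. We take the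
  left limit at \<^term>\<open>1\<close> (the usual formula \<open>inf {s. measure {\<bar>f\<bar> > s} \<le> t}\<close> would give \<open>0\<close> at
  \<open>t = 1\<close>, and then only the zero function would be regular).
  Outside \<^term>\<open>unit_I\<close> the value is the dummy \<^term>\<open>0\<close>.\<close>

definition decr_rearr :: "(real \<Rightarrow> real) \<Rightarrow> real \<Rightarrow> real" where
  "decr_rearr f = (THE g. is_rearrangement f g \<and> (g \<longlongrightarrow> g 1) (at_left 1) \<and>
                          (\<forall>t. t \<notin> unit_I \<longrightarrow> g t = 0))"

definition decr_rearr_avg :: "(real \<Rightarrow> real) \<Rightarrow> real \<Rightarrow> real" where
  "decr_rearr_avg f t = (1 / t) * (LINT x:{0<..t}|lebesgue. decr_rearr f x)"

definition regular :: "(real \<Rightarrow> real) \<Rightarrow> bool" where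
  "regular f \<longleftrightarrow> f absolutely_integrable_on unit_I \<and>
     (\<exists>K>0. \<forall>t\<in>unit_I. decr_rearr_avg f t \<le> K * decr_rearr f t)"

text \<open>The description in the definition of \<^term>\<open>decr_rearr\<close> is a proper one: for integrable
  functions there is exactly one such \<^term>\<open>g\<close>.\<close>

lemma lmeasurable_Ioc [simp]: "{a<..b::real} \<in> lmeasurable"
  by (rule bounded_set_imp_lmeasurable) (auto intro: bounded_subset[of "{a..b}"])

lemma is_rearrangement_le:
  assumes g: "is_rearrangement f g" and h: "is_rearrangement f h" and t: "0 < t" "t < 1"
  shows "h t \<le> g t"
proof (rule ccontr)
  assume "\<not> h t \<le> g t"
  then obtain s where s: "g t < s" "s < h t" using dense[of "g t" "h t"] by auto
  have "continuous (at t within {t..1}) h"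
    using h t by (auto simp: is_rearrangement_def unit_I_def)
  then have "\<forall>\<^sub>F x in at t within {t..1}. s < h x"
    using s(2) by (simp add: continuous_within order_tendstoD(1))
  then obtain d where d: "d > 0" "\<And>x. x \<in> {t..1} \<Longrightarrow> x \<noteq> t \<Longrightarrow> dist x t < d \<Longrightarrow> s < h x"
    by (auto simp: eventually_at)
  define u where "u = min ((t+1)/2) (t + d/2)"
  have u: "t < u" "u < 1" "dist u t < d" using d(1) t by (auto simp: u_def dist_real_def min_def)
  have hu: "s < h u" using d(2)[of u] u by auto
  have mono_h: "h y \<le> h x" if "x \<in> unit_I" "y \<in> unit_I" "x \<le> y" for x y
    using h that by (auto simp: is_rearrangement_def monotone_on_def)
  have mono_g: "g y \<le> g x" if "x \<in> unit_I" "y \<in> unit_I" "x \<le> y" for x y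
    using g that by (auto simp: is_rearrangement_def monotone_on_def)
  have lm: "{x \<in> unit_I. k x > s} \<in> lmeasurable"
    if "\<And>x y. x \<in> unit_I \<Longrightarrow> y \<in> unit_I \<Longrightarrow> x \<le> y \<Longrightarrow> k y \<le> k x" for k :: "real \<Rightarrow> real"
  proof -
    have "is_interval {x \<in> unit_I. k x > s}"
      unfolding is_interval_1
    proof safe
      fix a b x assume *: "a \<in> unit_I" "s < k a" "b \<in> unit_I" "s < k b" "a \<le> x" "x \<le> b"
      then show "x \<in> unit_I" by (simp add: unit_I_def)
      then show "s < k x" using that[of x b] * by simp
    qed
    moreover have "bounded {x \<in> unit_I. k x > s}"
      by (rule bounded_subset[of "{0..1::real}"]) (auto simp: unit_I_def)
    ultimately show ?thesis
      by (intro measurable_convex) (auto simp: is_interval_convex)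
  qed
  have "u = measure lebesgue {0<..u}" using u t by simp
  also have "\<dots> \<le> measure lebesgue {x \<in> unit_I. h x > s}"
  proof (rule measure_mono_fmeasurable)
    show "{0<..u} \<subseteq> {x \<in> unit_I. s < h x}"
    proof
      fix x assume x: "x \<in> {0<..u}"
      then have "x \<in> unit_I" "u \<in> unit_I" using u t by (auto simp: unit_I_def)
      then show "x \<in> {x \<in> unit_I. s < h x}" using mono_h[of x u] x hu by simp
    qed
  qed (use lm mono_h in auto)
  also have "\<dots> = measure lebesgue {x \<in> unit_I. g x > s}"
    using g h by (simp add: is_rearrangement_def)
  also have "\<dots> \<le> measure lebesgue {0<..t}"
  proof (rule measure_mono_fmeasurable)
    show "{x \<in> unit_I. s < g x} \<subseteq> {0<..t}"
    proof
      fix x assume x: "x \<in> {x \<in> unit_I. s < g x}"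
      have "t \<in> unit_I" using t by (simp add: unit_I_def)
      then have "\<not> t \<le> x" using mono_g[of t x] x s by auto
      then show "x \<in> {0<..t}" using x by (simp add: unit_I_def)
    qed
    show "{x \<in> unit_I. s < g x} \<in> sets lebesgue" using lm[of g] mono_g by (simp add: fmeasurableD)
  qed auto
  also have "\<dots> = t" using t by simp
  finally show False using u by simp
qed

lemma is_rearrangement_unique:
  assumes "is_rearrangement f g" "is_rearrangement f h" "0 < t" "t < 1"
  shows "g t = h t"
  using is_rearrangement_le assms by (meson antisym)

lemma ex1_rearrangement:
  assumes f: "f absolutely_integrable_on unit_I"
  shows "\<exists>!g. is_rearrangement f g \<and> (g \<longlongrightarrow> g 1) (at_left 1) \<and> (\<forall>t. t \<notin> unit_I \<longrightarrow> g t = 0)"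
proof (rule ex_ex1I)
  fix g h :: "real \<Rightarrow> real"
  assume g: "is_rearrangement f g \<and> (g \<longlongrightarrow> g 1) (at_left 1) \<and> (\<forall>t. t \<notin> unit_I \<longrightarrow> g t = 0)"
    and h: "is_rearrangement f h \<and> (h \<longlongrightarrow> h 1) (at_left 1) \<and> (\<forall>t. t \<notin> unit_I \<longrightarrow> h t = 0)"
  have eq: "g t = h t" if "0 < t" "t < 1" for t
    using is_rearrangement_unique g h that by blast
  have "\<forall>\<^sub>F t in at_left 1. g t = h t"
    using eq eventually_at_left_real[of 0 1] by (auto elim!: eventually_mono)
  then have "(g \<longlongrightarrow> h 1) (at_left 1)" using h by (simp add: filterlim_cong)
  then have g1h1: "g 1 = h 1"
    using g by (intro tendsto_unique[of "at_left (1::real)" g]) auto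
  show "g = h"
  proof
    fix t
    show "g t = h t"
    proof (cases "t \<in> unit_I")
      case True
      then consider "t = 1" | "0 < t" "t < 1" by (force simp: unit_I_def)
      then show ?thesis using g1h1 eq by cases auto
    next
      case False then show ?thesis using g h by simp
    qed
  qed
next
  define D where "D s = measure lebesgue {x \<in> unit_I. \<bar>f x\<bar> > s}" for s
  have I: "unit_I \<in> sets lebesgue" by (simp add: unit_I_def)
  have fm: "f \<in> borel_measurable (lebesgue_on unit_I)"
    using absolutely_integrable_measurable[OF I] f by blast
  have lm: "{x \<in> unit_I. \<bar>f x\<bar> > s} \<in> lmeasurable" for s
  proof (rule fmeasurableI2[of unit_I])
    show "unit_I \<in> lmeasurable" by (rule bounded_set_imp_lmeasurable) (auto simp: unit_I_def)
    have "{x \<in> space (lebesgue_on unit_I). \<bar>f x\<bar> > s} \<in> sets (lebesgue_on unit_I)"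
      using fm by measurable
    then show "{x \<in> unit_I. \<bar>f x\<bar> > s} \<in> sets lebesgue"
      using I by (simp add: sets_restrict_space_iff)
  qed auto
  have Dmono: "D s' \<le> D s" if "s \<le> s'" for s s'
    unfolding D_def using lm that by (intro measure_mono_fmeasurable) (auto simp: fmeasurableD)
  have Dle1: "D s \<le> 1" for s
  proof -
    have "D s \<le> measure lebesgue unit_I"
      unfolding D_def
    proof (rule measure_mono_fmeasurable)
      show "{x \<in> unit_I. s < \<bar>f x\<bar>} \<in> sets lebesgue" using lm[of s] by (rule fmeasurableD)
      show "unit_I \<in> lmeasurable" by (simp add: unit_I_def)
    qed auto
    then show ?thesis by (simp add: unit_I_def)
  qed
  have Dneg: "D s = 1" if "s < 0" for s
  proof -
    have "{x \<in> unit_I. \<bar>f x\<bar> > s} = unit_I" using that by (auto intro: less_le_trans)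
    then show ?thesis unfolding D_def by (simp add: unit_I_def)
  qed
  have Dlim: "(\<lambda>n. D (real n)) \<longlonglongrightarrow> 0"
  proof -
    have "(\<lambda>n. measure lebesgue {x \<in> unit_I. \<bar>f x\<bar> > real n})
            \<longlonglongrightarrow> measure lebesgue (\<Inter>n. {x \<in> unit_I. \<bar>f x\<bar> > real n})"
    proof (rule Lim_measure_decseq)
      show "range (\<lambda>n. {x \<in> unit_I. \<bar>f x\<bar> > real n}) \<subseteq> sets lebesgue"
        using lm by (auto simp: fmeasurableD)
      show "decseq (\<lambda>n. {x \<in> unit_I. \<bar>f x\<bar> > real n})" by (auto simp: decseq_def)
      show "emeasure lebesgue {x \<in> unit_I. \<bar>f x\<bar> > real n} \<noteq> \<infinity>" for n
        using lm by (metis fmeasurableD2 infinity_ennreal_def)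
    qed
    moreover have "(\<Inter>n. {x \<in> unit_I. \<bar>f x\<bar> > real n}) = {}"
    proof (intro equals0I)
      fix x assume x: "x \<in> (\<Inter>n. {x \<in> unit_I. \<bar>f x\<bar> > real n})"
      obtain n where "\<bar>f x\<bar> < real n" using reals_Archimedean2 by blast
      moreover have "real n < \<bar>f x\<bar>" using x by blast
      ultimately show False by simp
    qed
    ultimately show ?thesis by (simp add: D_def)
  qed
  have Drc: "\<exists>s'>s. D s' > t" if "D s > t" for s t
  proof -
    have "(\<lambda>n. measure lebesgue {x \<in> unit_I. \<bar>f x\<bar> > s + 1 / Suc n})
            \<longlonglongrightarrow> measure lebesgue (\<Union>n. {x \<in> unit_I. \<bar>f x\<bar> > s + 1 / Suc n})"
    proof (rule Lim_measure_incseq)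
      show "range (\<lambda>n. {x \<in> unit_I. \<bar>f x\<bar> > s + 1 / Suc n}) \<subseteq> sets lebesgue"
        using lm by (auto simp: fmeasurableD)
      show "incseq (\<lambda>n. {x \<in> unit_I. \<bar>f x\<bar> > s + 1 / Suc n})"
      proof (rule incseq_SucI, clarsimp)
        fix n x assume "s + 1 / (1 + real n) < \<bar>f x\<bar>"
        moreover have "1 / (2 + real n) \<le> 1 / (1 + real n)" by (simp add: frac_le)
        ultimately show "s + 1 / (2 + real n) < \<bar>f x\<bar>" by linarith
      qed
      have "emeasure lebesgue (\<Union>n. {x \<in> unit_I. \<bar>f x\<bar> > s + 1 / Suc n}) \<le> emeasure lebesgue unit_I"
        using I by (intro emeasure_mono) auto
      also have "\<dots> < \<infinity>" by (simp add: unit_I_def)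
      finally show "emeasure lebesgue (\<Union>n. {x \<in> unit_I. \<bar>f x\<bar> > s + 1 / Suc n}) \<noteq> \<infinity>" by simp
    qed
    moreover have "(\<Union>n. {x \<in> unit_I. \<bar>f x\<bar> > s + 1 / Suc n}) = {x \<in> unit_I. \<bar>f x\<bar> > s}"
    proof (intro equalityI subsetI)
      fix x assume x: "x \<in> {x \<in> unit_I. \<bar>f x\<bar> > s}"
      then obtain n where "1 / Suc n < \<bar>f x\<bar> - s"
        using nat_approx_posE[of "\<bar>f x\<bar> - s"] by auto
      then have "s + 1 / Suc n < \<bar>f x\<bar>" by linarith
      with x show "x \<in> (\<Union>n. {x \<in> unit_I. \<bar>f x\<bar> > s + 1 / Suc n})" by blast
    next
      fix x assume "x \<in> (\<Union>n. {x \<in> unit_I. \<bar>f x\<bar> > s + 1 / Suc n})"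
      then obtain n where x: "x \<in> unit_I" "s + 1 / Suc n < \<bar>f x\<bar>" by blast
      have "0 < 1 / real (Suc n)" by simp
      then have "s < \<bar>f x\<bar>" using x(2) by linarith
      with x(1) show "x \<in> {x \<in> unit_I. \<bar>f x\<bar> > s}" by simp
    qed
    ultimately have "(\<lambda>n. D (s + 1 / Suc n)) \<longlonglongrightarrow> D s" by (simp add: D_def)
    then have "\<forall>\<^sub>F n in sequentially. D (s + 1 / Suc n) > t" using that order_tendstoD(1) by blast
    then obtain n where "D (s + 1 / Suc n) > t" by (auto simp: eventually_sequentially)
    then show ?thesis by (intro exI[of _ "s + 1 / Suc n"]) auto
  qed
  define A where "A t = {s. 0 \<le> s \<and> D s \<le> t}" for t
  define h where "h t = Inf (A t)" for t
  have Ane: "A t \<noteq> {}" if "t > 0" for t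
  proof -
    have "\<forall>\<^sub>F n in sequentially. D (real n) < t" using Dlim that order_tendstoD(2) by blast
    then obtain n where "D (real n) < t" by (auto simp: eventually_sequentially)
    then have "real n \<in> A t" by (simp add: A_def)
    then show ?thesis by blast
  qed
  have Abdd: "bdd_below (A t)" for t by (rule bdd_belowI[of _ 0]) (auto simp: A_def)
  have h0: "h t \<ge> 0" if "t > 0" for t
    unfolding h_def using Ane[OF that] by (intro cInf_greatest) (auto simp: A_def)
  have hiff: "s < h t \<longleftrightarrow> D s > t" if t: "0 < t" "t < 1" for s t
  proof
    assume "s < h t"
    show "D s > t"
    proof (cases "s < 0")
      case True then show ?thesis using Dneg t by simp
    next
      case False
      show ?thesis
      proof (rule ccontr)
        assume "\<not> D s > t"
        then have "s \<in> A t" using False by (simp add: A_def)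
        then have "h t \<le> s" unfolding h_def using Abdd by (rule cInf_lower)
        with \<open>s < h t\<close> show False by simp
      qed
    qed
  next
    assume "D s > t"
    then obtain s' where s': "s' > s" "D s' > t" using Drc by blast
    have "s' \<le> h t" unfolding h_def
    proof (rule cInf_greatest[OF Ane])
      fix r assume "r \<in> A t"
      then have "D r < D s'" using s' by (simp add: A_def)
      then show "s' \<le> r" using Dmono[of r s'] by linarith
    qed (use t in auto)
    then show "s < h t" using s' by simp
  qed
  have hmono: "h y \<le> h x" if "0 < x" "x \<le> y" "y < 1" for x y
  proof (rule ccontr)
    assume "\<not> h y \<le> h x"
    then have "D (h x) > y" using hiff[of y "h x"] that by simp
    then have "h x < h x" using hiff[of x "h x"] that by simp
    then show False by simp
  qed
  define L where "L = Inf (h ` {0<..<1})"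
  have Lb: "bdd_below (h ` {0<..<1})" by (rule bdd_belowI[of _ 0]) (auto intro: h0)
  have L: "L \<le> h t" if "0 < t" "t < 1" for t
    unfolding L_def using Lb that by (intro cInf_lower) auto
  define g where "g t = (if t \<in> unit_I then if t < 1 then h t else L else 0)" for t
  have gh: "g t = h t" if "0 < t" "t < 1" for t using that by (simp add: g_def unit_I_def)
  have g1: "g 1 = L" by (simp add: g_def unit_I_def)
  have Llim: "(g \<longlongrightarrow> g 1) (at_left 1)"
  proof (rule order_tendstoI)
    fix a assume "a < g 1"
    then have "a < g t" if "0 < t" "t < 1" for t using L that gh g1 by (metis less_le_trans)
    then show "\<forall>\<^sub>F t in at_left 1. a < g t"
      using eventually_at_left_real[of 0 1] by (auto elim!: eventually_mono)
  next
    fix a assume "g 1 < a"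
    then have "\<exists>y\<in>h ` {0<..<1}. y < a" 
      using g1 cInf_lessD[of "h ` {0<..<1}" a] by (auto simp: L_def)
    then obtain t where t: "0 < t" "t < 1" "h t < a" by auto
    then have "g x < a" if "t < x" "x < 1" for x
      using hmono[of t x] gh[of x] that by auto
    then show "\<forall>\<^sub>F t in at_left 1. g t < a"
      using eventually_at_left_real[of t 1] t by (auto elim!: eventually_mono)
  qed
  have anti: "antimono_on unit_I g"
  proof (rule monotone_onI)
    fix x y assume xy: "x \<in> unit_I" "y \<in> unit_I" "x \<le> y"
    show "g y \<le> g x"
    proof (cases "y < 1")
      case True then show ?thesis using xy hmono[of x y] gh by (auto simp: unit_I_def)
    next
      case False
      then have "y = 1" using xy by (auto simp: unit_I_def)
      then show ?thesis using xy L[of x] gh[of x] g1 by (cases "x = 1") (auto simp: unit_I_def)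
    qed
  qed
  have rc: "continuous (at t within {t..1}) g" if "t \<in> unit_I" for t
  proof (cases "t < 1")
    case False
    then have "t = 1" using that by (auto simp: unit_I_def)
    then show ?thesis by (simp add: continuous_within at_within_def)
  next
    case True
    then have t: "0 < t" "t < 1" using that by (auto simp: unit_I_def)
    show ?thesis unfolding continuous_within
    proof (rule order_tendstoI)
      fix a assume "a < g t"
      then have "D a > t" using hiff[of t a] gh t by simp
      define d where "d = min (D a) 1 - t"
      have "d > 0" using \<open>D a > t\<close> t by (simp add: d_def)
      moreover have "a < g x" if "x \<in> {t..1}" "dist x t < d" for x
      proof -
        have "x < D a" "x < 1" using that by (auto simp: d_def dist_real_def)
        then show ?thesis using hiff[of x a] gh[of x] that t by auto
      qed
      ultimately show "\<forall>\<^sub>F x in at t within {t..1}. a < g x"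
        unfolding eventually_at by blast
    next
      fix a assume "g t < a"
      moreover have "g x \<le> g t" if "x \<in> {t..1}" for x
        using anti that t by (auto simp: monotone_on_def unit_I_def)
      ultimately show "\<forall>\<^sub>F x in at t within {t..1}. g x < a"
        unfolding eventually_at by (intro exI[of _ 1]) force
    qed
  qed
  have eqm: "measure lebesgue {x \<in> unit_I. g x > s} = D s" for s
  proof -
    have D0: "D s \<ge> 0" by (simp add: D_def)
    have eq: "{x \<in> unit_I. g x > s} - {1} = {0<..<D s}"
    proof (rule set_eqI)
      fix x
      show "x \<in> {x \<in> unit_I. g x > s} - {1} \<longleftrightarrow> x \<in> {0<..<D s}"
      proof (cases "0 < x \<and> x < 1")
        case True then show ?thesis using hiff[of x s] gh[of x] by (auto simp: unit_I_def)
      next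
        case False then show ?thesis using Dle1[of s] by (auto simp: unit_I_def)
      qed
    qed
    have "negligible ({x \<in> unit_I. g x > s} - {0<..<D s} \<union> ({0<..<D s} - {x \<in> unit_I. g x > s}))"
      by (rule negligible_subset[of "{1}"]) (use eq in auto)
    then have "measure lebesgue {x \<in> unit_I. g x > s} = measure lebesgue {0<..<D s}"
      by (intro measure_negligible_symdiff) (auto simp: Un_commute bounded_set_imp_lmeasurable)
    then show ?thesis using D0 by simp
  qed
  have "is_rearrangement f g"
    using anti rc eqm by (simp add: is_rearrangement_def D_def)
  moreover have "\<forall>t. t \<notin> unit_I \<longrightarrow> g t = 0" by (simp add: g_def)
  ultimately show "\<exists>g. is_rearrangement f g \<and> (g \<longlongrightarrow> g 1) (at_left 1) \<and>
                       (\<forall>t. t \<notin> unit_I \<longrightarrow> g t = 0)"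
    using Llim by blast
qed

lemma is_rearrangement_decr_rearr:
  assumes "f absolutely_integrable_on unit_I"
  shows "is_rearrangement f (decr_rearr f)"
  using theI'[OF ex1_rearrangement[OF assms]] by (simp add: decr_rearr_def)

lemma decr_rearr_eq:
  assumes "f absolutely_integrable_on unit_I" "is_rearrangement f f" "0 < t" "t < 1"
  shows "decr_rearr f t = f t"
  using assms is_rearrangement_decr_rearr is_rearrangement_unique by blast

end

theory Submission
  imports Defs
begin

text \<open>
  Write \<open>g\<close> for the decreasing rearrangement of \<open>f\<close> and \<open>F t\<close> for its integral over \<open>(0,t]\<close>, so
  that the average in question is \<open>F t / t\<close>. The proof is a discrete version of solving the
  differential inequality \<open>F t \<le> K * t * F' t\<close>. Regularity says \<open>F t \<le> K * t * g t\<close>, and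
  since \<open>g\<close> decreases, the mass that it carries on the right half \<open>(t/2,t]\<close> is at least
  \<open>(t/2) * g t\<close>, hence at least the fixed fraction \<open>1 / (2 * K)\<close> of \<open>F t\<close>. So halving \<open>t\<close>
  multiplies \<open>F\<close> by at most \<open>\<theta> = 1 - 1 / (2 * K) < 1\<close>
  (\<open>integral_half_le_of_average_le\<close>).
  Iterating this geometric decay over dyadic scales and writing \<open>\<theta> = 2 powr (- \<epsilon>)\<close> gives
  \<open>F t \<le> C * t powr \<epsilon>\<close> (\<open>powr_bound_of_halving\<close>), which is the claim with
  \<open>\<delta> = 1 - \<epsilon>\<close>. Enlarging \<open>K\<close> to at least \<open>2\<close> makes \<open>\<theta> > 1/2\<close>, that is \<open>\<epsilon> < 1\<close>
  and \<open>\<delta> > 0\<close>.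
\<close>

text \<open>Geometric decay with ratio \<open>2 powr (- \<epsilon>)\<close> under halving is decay like \<open>t powr \<epsilon>\<close>. The factor
  \<open>2 powr \<epsilon>\<close> pays for the points between consecutive powers of \<open>1/2\<close>.\<close>

lemma powr_bound_of_halving:
  fixes F :: "real \<Rightarrow> real" and \<epsilon> :: real
  assumes \<epsilon>: "0 \<le> \<epsilon>" and F1: "0 \<le> F 1"
    and le1: "\<And>t. 0 < t \<Longrightarrow> t \<le> 1 \<Longrightarrow> F t \<le> F 1"
    and half: "\<And>t. 0 < t \<Longrightarrow> t \<le> 1 \<Longrightarrow> F (t / 2) \<le> 2 powr (- \<epsilon>) * F t"
    and t: "0 < t" "t \<le> 1"
  shows "F t \<le> 2 powr \<epsilon> * F 1 * t powr \<epsilon>"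
proof -
  obtain n where "(1/2) ^ n < t" using real_arch_pow_inv[of t "1/2"] t by auto
  then show ?thesis using t
  proof (induction n arbitrary: t)
    case 0
    then show ?case by simp
  next
    case (Suc n)
    show ?case
    proof (cases "1/2 < t")
      case True
      have "F t \<le> F 1" using le1 Suc.prems by simp
      also have "\<dots> \<le> (2 * t) powr \<epsilon> * F 1"
        using True \<epsilon> F1 ge_one_powr_ge_zero[of "2 * t" \<epsilon>]
          mult_right_mono[of 1 "(2 * t) powr \<epsilon>" "F 1"] by simp
      also have "\<dots> = 2 powr \<epsilon> * F 1 * t powr \<epsilon>" using Suc.prems by (simp add: powr_mult)
      finally show ?thesis .
    next
      case False
      have "F t = F (2 * t / 2)" by simp
      also have "\<dots> \<le> 2 powr (- \<epsilon>) * F (2 * t)" using half[of "2 * t"] False Suc.prems by simp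
      also have "\<dots> \<le> 2 powr (- \<epsilon>) * (2 powr \<epsilon> * F 1 * (2 * t) powr \<epsilon>)"
        using Suc.IH[of "2 * t"] Suc.prems False by (intro mult_left_mono) auto
      also have "\<dots> = 2 powr \<epsilon> * F 1 * t powr \<epsilon>"
        using Suc.prems by (simp add: powr_mult powr_minus field_simps)
      finally show ?thesis .
    qed
  qed
qed

text \<open>If \<open>g t\<close> were negative, the level set \<open>{\<bar>f\<bar> > g t}\<close> would have full measure, whereas
  \<open>{g > g t}\<close> is contained in \<open>(0,t]\<close>.\<close>

lemma is_rearrangement_nonneg:
  assumes g: "is_rearrangement f g" and t: "0 < t" "t < 1"
  shows "0 \<le> g t"
proof (rule ccontr)
  assume neg: "\<not> 0 \<le> g t"
  have anti: "g y \<le> g x" if "x \<in> unit_I" "y \<in> unit_I" "x \<le> y" for x y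
    using g that by (auto simp: is_rearrangement_def monotone_on_def)
  have "{x \<in> unit_I. \<bar>f x\<bar> > g t} = {0<..1}"
    using neg by (auto simp: unit_I_def intro: less_le_trans[of _ 0])
  then have one: "measure lebesgue {x \<in> unit_I. g x > g t} = 1"
    using g by (simp add: is_rearrangement_def)
  have "{x \<in> unit_I. g x > g t} \<subseteq> {0<..t}"
  proof
    fix x assume x: "x \<in> {x \<in> unit_I. g x > g t}"
    then have "\<not> t \<le> x" using anti[of t x] t by (auto simp: unit_I_def)
    then show "x \<in> {0<..t}" using x by (simp add: unit_I_def)
  qed
  moreover have "{x \<in> unit_I. g x > g t} \<in> sets lebesgue"
    \<comment> \<open>a set that is not measurable would have measure \<open>0\<close>, not \<open>1\<close>\<close>
    using one measure_notin_sets[of _ lebesgue] by force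
  ultimately have "measure lebesgue {x \<in> unit_I. g x > g t} \<le> measure lebesgue {0<..t}"
    by (intro measure_mono_fmeasurable) auto
  then show False using one t by simp
qed

text \<open>The right half \<open>(t/2,t]\<close> carries at least \<open>(t/2) * g t\<close> of the integral of a decreasing
  function, and the hypothesis on the average makes this a fixed fraction of the whole.\<close>

lemma integral_half_le_of_average_le:
  fixes g :: "real \<Rightarrow> real"
  assumes int: "set_integrable lebesgue {0<..t} g" and t: "0 < t" and K: "0 < K"
    and anti: "\<And>x. 0 < x \<Longrightarrow> x \<le> t \<Longrightarrow> g t \<le> g x"
    and avg: "(1 / t) * (LINT x:{0<..t}|lebesgue. g x) \<le> K * g t"
  shows "(LINT x:{0<..t/2}|lebesgue. g x) \<le> (1 - 1 / (2 * K)) * (LINT x:{0<..t}|lebesgue. g x)"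
proof -
  let ?F = "\<lambda>s. LINT x:{0<..s}|lebesgue. g x"
  have int1: "set_integrable lebesgue {0<..t/2} g" and int2: "set_integrable lebesgue {t/2<..t} g"
    using t by (auto intro: set_integrable_subset[OF int])
  have "{0<..t} = {0<..t/2} \<union> {t/2<..t}" using t by auto
  then have split: "?F t = ?F (t/2) + (LINT x:{t/2<..t}|lebesgue. g x)"
    using set_integral_Un[OF _ int1 int2] by auto
  have "?F t / (2 * K) \<le> (t/2) * g t" using avg t K by (simp add: field_simps)
  also have "\<dots> = (LINT x:{t/2<..t}|lebesgue. g t)"
    using t by (simp add: set_integral_const fmeasurableD fmeasurableD2)
  also have "\<dots> \<le> (LINT x:{t/2<..t}|lebesgue. g x)"
    using t anti
    by (intro set_integral_mono int2) (auto intro!: absolutely_integrable_on_const)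
  finally have "?F t / (2 * K) \<le> ?F t - ?F (t/2)" unfolding split by simp
  then show ?thesis by (simp add: left_diff_distrib)
qed

theorem theorem1p18:
  fixes f :: "real \<Rightarrow> real"
  assumes "f absolutely_integrable_on unit_I"
    and "is_rearrangement f f"
    and "regular f"
  shows "\<exists>\<delta> C :: real. 0 < \<delta> \<and> \<delta> < 1 \<and> C > 0 \<and>
           (\<forall>t\<in>unit_I. decr_rearr_avg f t \<le> C * t powr (- \<delta>))"
proof -
  define g where "g = decr_rearr f"
  define F where "F t = (LINT x:{0<..t}|lebesgue. g x)" for t
  have avg: "decr_rearr_avg f t = F t / t" for t
    by (simp add: decr_rearr_avg_def F_def g_def)
  have g: "is_rearrangement f g"
    using is_rearrangement_decr_rearr[OF assms(1)] by (simp add: g_def)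
  have anti: "g y \<le> g x" if "0 < x" "x \<le> y" "y \<le> 1" for x y
    using g that by (auto simp: is_rearrangement_def monotone_on_def unit_I_def)
  have g0: "0 \<le> g t" if "0 < t" "t < 1" for t
    using is_rearrangement_nonneg[OF g that] .

  \<comment> \<open>on \<open>(0,1]\<close> the functions \<open>f\<close> and \<open>g\<close> can differ only at the point \<open>1\<close>\<close>
  have "g absolutely_integrable_on unit_I"
    by (rule absolutely_integrable_spike[OF assms(1), of "{1}"])
      (auto simp: g_def unit_I_def intro!: decr_rearr_eq assms)
  then have int: "set_integrable lebesgue {0<..t} g" if "t \<le> 1" for t
    using that by (auto simp: unit_I_def intro: set_integrable_subset)
  have AE1: "AE x in lebesgue. x \<noteq> (1::real)"
    by (intro AE_I'[of "{1}"]) (auto simp: negligible_iff_null_sets[symmetric])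
  have F0: "0 \<le> F 1"
    unfolding F_def set_lebesgue_integral_def
    by (rule integral_nonneg_AE) (use AE1 g0 in \<open>auto elim!: eventually_mono simp: indicator_def\<close>)
  have F1: "F t \<le> F 1" if "0 < t" "t \<le> 1" for t
    unfolding F_def set_lebesgue_integral_def
    by (rule integral_mono_AE)
      (use int[OF that(2)] int[of 1] AE1 g0 that in
        \<open>auto elim!: eventually_mono simp: indicator_def set_integrable_def\<close>)

  obtain K where K: "0 < K" "\<And>t. t \<in> unit_I \<Longrightarrow> F t / t \<le> K * g t"
    using assms(3) by (auto simp: regular_def avg g_def)
  \<comment> \<open>monotonicity bounds \<open>g 1\<close> only from above; regularity gives the lower bound\<close>
  have "0 \<le> K * g 1" using K(2)[of 1] F0 by (simp add: unit_I_def)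
  then have "0 \<le> g 1" using K(1) by (simp add: zero_le_mult_iff)
  then have g0': "0 \<le> g t" if "0 < t" "t \<le> 1" for t
    using g0[of t] that by (cases "t = 1") auto
  define L where "L = max K 2"
  define \<theta> where "\<theta> = 1 - 1 / (2 * L)"
  define \<epsilon> where "\<epsilon> = - log 2 \<theta>"
  have L: "2 \<le> L" "K \<le> L" by (auto simp: L_def)
  then have \<theta>: "1/2 < \<theta>" "\<theta> < 1" by (auto simp: \<theta>_def field_simps)
  have \<epsilon>: "0 < \<epsilon>" "\<epsilon> < 1" "2 powr (- \<epsilon>) = \<theta>"
    using \<theta> log_less_cancel_iff[of 2 "1/2" \<theta>] by (auto simp: \<epsilon>_def log_divide)

  have half: "F (t/2) \<le> 2 powr (- \<epsilon>) * F t" if t: "0 < t" "t \<le> 1" for t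
  proof -
    have "F t / t \<le> K * g t" using K t by (simp add: unit_I_def)
    also have "\<dots> \<le> L * g t" using L g0'[OF t] by (intro mult_right_mono) auto
    finally have "(1 / t) * (LINT x:{0<..t}|lebesgue. g x) \<le> L * g t" by (simp add: F_def)
    then show ?thesis
      unfolding \<epsilon>(3) \<theta>_def F_def using L t int anti
      by (intro integral_half_le_of_average_le) auto
  qed
  have bound: "F t \<le> 2 powr \<epsilon> * F 1 * t powr \<epsilon>" if "t \<in> unit_I" for t
    using that \<epsilon> F0 F1 half by (intro powr_bound_of_halving) (auto simp: unit_I_def)
  \<comment> \<open>the summand \<open>1\<close> keeps \<open>C\<close> positive when \<open>F 1 = 0\<close>\<close>
  define C where "C = 2 powr \<epsilon> * F 1 + 1"
  have "decr_rearr_avg f t \<le> C * t powr (- (1 - \<epsilon>))" if t: "t \<in> unit_I" for t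
  proof -
    have pos: "0 < t" using t by (simp add: unit_I_def)
    have "F t / t \<le> (C * t powr \<epsilon>) / t"
    proof (intro divide_right_mono)
      have "2 powr \<epsilon> * F 1 * t powr \<epsilon> \<le> C * t powr \<epsilon>"
        by (intro mult_right_mono) (simp_all add: C_def)
      then show "F t \<le> C * t powr \<epsilon>" using bound[OF t] by simp
    qed (use pos in simp)
    also have "\<dots> = C * t powr (- (1 - \<epsilon>))"
      using pos by (simp add: powr_diff)
    finally show ?thesis by (simp add: avg)
  qed
  moreover have "0 < C" using F0 by (simp add: C_def add_nonneg_pos)
  ultimately show ?thesis using \<epsilon> by (intro exI[of _ "1 - \<epsilon>"] exI[of _ C]) auto
qed

end
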